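(* Let $\ell\ge 1$ be an integer and let $S_{2,\ell}$ be the double star graph with central vertices $u$ (of degree $3$) and $v$ (of degree $\ell+1$). Let $u_1$ and $u_2$ be the two vertices of degree one adjacent to $u$. Then $S_{2,\ell}$ has pretty good state transfer from $u_1$ to $u_2$ if and only if $\ell\neq 2$.
   Context: Graphs are finite, simple and undirected. For a star with $k$ edges and a star with $\ell$ edges, the double star graph $S_{k,\ell}$ is obtained by joining the two centers by a new edge; the two central vertices then have degrees $k+1$ and $\ell+1$ and all other vertices have degree one. Let $A$ be the adjacency matrix of a graph and $U(t)=\exp(itA)$ for $t\in\mathbb{R}$; $e_a$ denotes the standard basis vector indexed by the vertex $a$. For distinct vertices $a,b$ there is pretty good state transfer from $a$ to $b$ if there is a complex number $\gamma$ (necessarily $|\gamma|=1$) such that for each real $\epsilon>0$ there is a time $t\in\mathbb{R}$ with $\|U(t)e_a-\gamma e_b\|<\epsilon$. *)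

theory Defs
  imports "HOL-Analysis.Analysis"
begin

text \<open>
  A graph is given by its set of edges, each edge being a set of two vertices; its vertices are
  all the elements of a finite type, so that they can index the vectors and matrices of
  HOL-Analysis.
\<close>

definition simple_graph :: "'v::finite set set \<Rightarrow> bool" where
  "simple_graph E \<longleftrightarrow> (\<forall>e\<in>E. card e = 2)"

definition degree :: "'v::finite set set \<Rightarrow> 'v \<Rightarrow> nat" where
  "degree E a = card {b. {a, b} \<in> E}"

definition star_edges :: "'v \<Rightarrow> 'v set \<Rightarrow> 'v set set" where
  "star_edges c L = {{c, w} | w. w \<in> L}"

definition double_star :: "nat \<Rightarrow> nat \<Rightarrow> 'v::finite set set \<Rightarrow> 'v \<Rightarrow> 'v \<Rightarrow> bool" where
  "double_star k l E u v \<longleftrightarrow>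
     (\<exists>K L. card K = k \<and> card L = l \<and> u \<noteq> v \<and>
            K \<inter> L = {} \<and> {u, v} \<inter> (K \<union> L) = {} \<and> {u, v} \<union> K \<union> L = UNIV \<and>
            E = star_edges u K \<union> star_edges v L \<union> {{u, v}})"

definition adjacency_matrix :: "'v::finite set set \<Rightarrow> complex ^ 'v ^ 'v" where
  "adjacency_matrix E = (\<chi> a b. if {a, b} \<in> E then 1 else 0)"

text \<open>
  Square matrices with \<open>**\<close> are not an instance of the algebra class on which the library's
  \<open>exp\<close> is defined, so the same power series is written out for them.
\<close>

definition matrix_power :: "complex ^ 'n ^ 'n \<Rightarrow> nat \<Rightarrow> complex ^ 'n ^ 'n" where
  "matrix_power A n = ((\<lambda>B. A ** B) ^^ n) (mat 1)"

definition matrix_exp :: "complex ^ 'n ^ 'n \<Rightarrow> complex ^ 'n ^ 'n" where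
  "matrix_exp A = (\<Sum>n. matrix_power A n /\<^sub>R fact n)"

definition transition_matrix :: "'v::finite set set \<Rightarrow> real \<Rightarrow> complex ^ 'v ^ 'v" where
  "transition_matrix E t = matrix_exp (mat (\<i> * complex_of_real t) ** adjacency_matrix E)"

definition pretty_good_state_transfer :: "'v::finite set set \<Rightarrow> 'v \<Rightarrow> 'v \<Rightarrow> bool" where
  "pretty_good_state_transfer E a b \<longleftrightarrow>
     a \<noteq> b \<and>
     (\<exists>\<gamma>::complex. \<forall>\<epsilon>>0. \<exists>t::real.
        norm (transition_matrix E t *v axis a 1 - \<gamma> *s axis b 1) < \<epsilon>)"

lemma double_star_simple_graph:
  assumes "double_star k l E u v"
  shows "simple_graph E"
  using assms unfolding double_star_def simple_graph_def star_edges_def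
  by (auto simp: card_insert_if)

lemma double_star_degree_left:
  assumes "double_star k l E u v"
  shows "degree E u = k + 1"
proof -
  obtain K L where K: "card K = k" "u \<noteq> v" "{u, v} \<inter> (K \<union> L) = {}"
    and E: "E = star_edges u K \<union> star_edges v L \<union> {{u, v}}"
    using assms unfolding double_star_def by blast
  have "{b. {u, b} \<in> E} = insert v K"
    using K unfolding E star_edges_def by (auto simp: doubleton_eq_iff)
  then show ?thesis
    using K by (simp add: degree_def)
qed

lemma double_star_commute:
  assumes "double_star k l E u v"
  shows "double_star l k E v u"
proof -
  obtain K L where *: "card K = k" "card L = l" "u \<noteq> v" "K \<inter> L = {}"
    "{u, v} \<inter> (K \<union> L) = {}" "{u, v} \<union> K \<union> L = UNIV"
    "E = star_edges u K \<union> star_edges v L \<union> {{u, v}}"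
    using assms unfolding double_star_def by blast
  show ?thesis
    unfolding double_star_def
    by (rule exI[of _ L], rule exI[of _ K]) (use * in auto)
qed

lemma double_star_degree_right:
  assumes "double_star k l E u v"
  shows "degree E v = l + 1"
  by (rule double_star_degree_left[OF double_star_commute[OF assms]])

lemma double_star_exists:
  assumes "CARD('v::finite) = k + l + 2"
  shows "\<exists>E u v. double_star k l (E :: 'v set set) u v"
proof -
  obtain K :: "'v set" where K: "card K = k"
    using obtain_subset_with_card_n[of k "UNIV :: 'v set"] assms by auto
  have "card (- K) = l + 2"
    using K assms by (simp add: Compl_eq_Diff_UNIV card_Diff_subset)
  then obtain L where L: "L \<subseteq> - K" "card L = l"
    using obtain_subset_with_card_n[of l "- K"] by auto
  have "card (- K - L) = 2"
    using L \<open>card (- K) = l + 2\<close> by (simp add: card_Diff_subset)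
  then obtain u v where "- K - L = {u, v}" "u \<noteq> v"
    by (auto simp: card_2_iff)
  then have "double_star k l (star_edges u K \<union> star_edges v L \<union> {{u, v}}) u v"
    unfolding double_star_def using K L by blast
  then show ?thesis by blast
qed

end

(*
  Write e_u1 = (e_u1 - e_u2)/2 + (e_u1 + e_u2)/2. The first summand is in the kernel of A, hence fixed
  by U(t); the second lies in the span of eigenvectors for the roots a, -a, b, -b of
  x^4 - (l + 3) x^2 + 2 l. So e_u1 is nearly sent to -e_u2 as soon as exp (i t a) and exp (i t b) are
  both close to -1, which by Kronecker's theorem happens for some t if b / a is irrational.
  If b / a is rational, then so is a^2 - b^2 (because a^2 + b^2 = l + 3), whose square is
  (l - 1)^2 + 8; this is a perfect square only for l = 2. For l = 2 the return amplitude at u1 is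
  bounded away from 0.
*)

theory Submission
  imports Defs
begin

section \<open>The matrix exponential and its action on eigenvectors\<close>

lemma matrix_power_0 [simp]: "matrix_power A 0 = mat 1"
  by (simp add: matrix_power_def)

lemma matrix_power_Suc: "matrix_power A (Suc n) = A ** matrix_power A n"
  by (simp add: matrix_power_def)

text \<open>The entrywise l1 norm: it dominates the Euclidean norm and is submultiplicative, so it
  can bound matrix powers.\<close>

definition entry_sum :: "complex ^ 'n ^ 'm \<Rightarrow> real" where
  "entry_sum A = (\<Sum>i\<in>UNIV. \<Sum>j\<in>UNIV. norm (A $ i $ j))"

lemma norm_le_entry_sum: "norm A \<le> entry_sum A"
proof -
  have vec: "norm x \<le> (\<Sum>i\<in>UNIV. norm (x $ i))" for x :: "'c::real_normed_vector ^ 'k"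
    unfolding norm_vec_def by (rule L2_set_le_sum) simp
  show ?thesis
    unfolding entry_sum_def by (rule order_trans[OF vec sum_mono]) (rule vec)
qed

lemma entry_sum_mult_le: "entry_sum (A ** B) \<le> entry_sum A * entry_sum B"
  for A :: "complex ^ 'n ^ 'm" and B :: "complex ^ 'k ^ 'n"
proof -
  have "entry_sum (A ** B) \<le> (\<Sum>i\<in>UNIV. \<Sum>j\<in>UNIV. \<Sum>k\<in>UNIV. norm (A $ i $ k) * norm (B $ k $ j))"
    unfolding entry_sum_def matrix_matrix_mult_def
    by (intro sum_mono) (simp add: norm_mult sum_norm_le)
  also have "\<dots> = (\<Sum>i\<in>UNIV. \<Sum>k\<in>UNIV. norm (A $ i $ k) * (\<Sum>j\<in>UNIV. norm (B $ k $ j)))"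
    by (subst sum.swap) (simp add: sum_distrib_left)
  also have "\<dots> \<le> (\<Sum>i\<in>UNIV. \<Sum>k\<in>UNIV. norm (A $ i $ k) * entry_sum B)"
    unfolding entry_sum_def
    by (intro sum_mono mult_left_mono member_le_sum sum_nonneg) auto
  finally show ?thesis
    by (simp add: entry_sum_def sum_distrib_right)
qed

text \<open>Comparison with the scalar exponential series of \<open>entry_sum A\<close>.\<close>

lemma summable_matrix_exp:
  fixes A :: "complex^'n^'n"
  shows "summable (\<lambda>n. matrix_power A n /\<^sub>R fact n)"
proof (rule summable_comparison_test)
  have nonneg: "0 \<le> entry_sum A"
    by (simp add: entry_sum_def sum_nonneg)
  \<comment> \<open>The constant factor is needed at \<open>n = 0\<close>: the identity has entry
    sum equal to the dimension, not 1.\<close>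
  have pow: "entry_sum (matrix_power A n) \<le> entry_sum A ^ n * entry_sum (mat 1 :: complex^'n^'n)" for n
  proof (induction n)
    case (Suc n)
    have "entry_sum (matrix_power A (Suc n)) \<le> entry_sum A * entry_sum (matrix_power A n)"
      by (simp add: matrix_power_Suc entry_sum_mult_le)
    also have "\<dots> \<le> entry_sum A * (entry_sum A ^ n * entry_sum (mat 1 :: complex^'n^'n))"
      by (rule mult_left_mono[OF Suc nonneg])
    finally show ?case by (simp add: mult.assoc)
  qed simp
  show "\<exists>N. \<forall>n\<ge>N. norm (matrix_power A n /\<^sub>R fact n)
      \<le> (entry_sum A ^ n /\<^sub>R fact n) * entry_sum (mat 1 :: complex^'n^'n)"
    using order_trans[OF norm_le_entry_sum pow]
    by (auto simp: divide_simps mult.commute intro!: exI[of _ 0])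
  show "summable (\<lambda>n. (entry_sum A ^ n /\<^sub>R fact n) * entry_sum (mat 1 :: complex^'n^'n))"
    by (intro summable_mult2 summable_exp_generic)
qed

text \<open>Applying a matrix to \<open>w\<close> is linear and continuous in the matrix, so it
  passes through the power series, whose terms become those of the scalar series for
  \<open>exp c\<close>.\<close>

lemma matrix_exp_eigenvector:
  fixes A :: "complex^'n^'n"
  assumes "A *v w = c *s w"
  shows "matrix_exp A *v w = exp c *s w"
proof -
  have pow: "matrix_power A n *v w = c ^ n *s w" for n
  proof (induction n)
    case (Suc n)
    have "matrix_power A (Suc n) *v w = A *v (matrix_power A n *v w)"
      by (simp add: matrix_power_Suc matrix_vector_mul_assoc)
    then show ?case
      by (simp add: Suc vector_scalar_commute assms vector_smult_assoc mult.commute)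
  qed simp
  have scale: "(r *\<^sub>R B) *v w = r *\<^sub>R (B *v w)" for r and B :: "complex^'n^'n"
    by (simp add: vec_eq_iff matrix_vector_mult_def scaleR_sum_right)
  have "bounded_linear (\<lambda>B :: complex^'n^'n. B *v w)"
    by (intro linear_conv_bounded_linear[THEN iffD1] linearI)
       (simp_all add: scale matrix_vector_mult_add_rdistrib)
  then have lhs: "(\<lambda>n. (matrix_power A n /\<^sub>R fact n) *v w) sums (matrix_exp A *v w)"
    unfolding matrix_exp_def by (rule bounded_linear.sums) (rule summable_sums[OF summable_matrix_exp])
  have "bounded_linear (\<lambda>z. z *s w)"
    by (intro linear_conv_bounded_linear[THEN iffD1] linearI)
       (simp_all add: vec_eq_iff algebra_simps)
  then have "(\<lambda>n. (c ^ n /\<^sub>R fact n) *s w) sums (exp c *s w)"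
    by (rule bounded_linear.sums) (rule exp_converges)
  moreover have "(matrix_power A n /\<^sub>R fact n) *v w = (c ^ n /\<^sub>R fact n) *s w" for n
    by (simp add: scale pow vec_eq_iff)
  ultimately show ?thesis
    using sums_unique2[OF lhs] by simp
qed

lemma transition_matrix_eigenvector:
  assumes "adjacency_matrix E *v w = c *s w"
  shows "transition_matrix E t *v w = exp (\<i> * complex_of_real t * c) *s w"
proof -
  have mat: "mat z *v x = z *s x" for z :: complex and x :: "complex ^ 'a"
    by (simp add: vec_eq_iff matrix_vector_mult_def mat_def if_distrib if_distribR cong: if_cong)
  show ?thesis
    unfolding transition_matrix_def
    by (rule matrix_exp_eigenvector)
       (simp add: matrix_vector_mul_assoc[symmetric] assms mat vector_smult_assoc)
qed

section \<open>Eigenvectors of the double star and the evolution of a leaf\<close>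

lemma adjacency_matrix_mult_nth:
  "(adjacency_matrix E *v y) $ a = (\<Sum>b | {a, b} \<in> E. y $ b)"
  unfolding adjacency_matrix_def matrix_vector_mult_def
  by (auto intro!: sum.mono_neutral_cong_right split: if_splits)

text \<open>
  The eigenvalue equation, normalised to \<open>1\<close> on \<open>K\<close>, determines the entries when read off at \<open>K\<close>, at
  \<open>u\<close> and at the leaves of \<open>v\<close>; the remaining equation at \<open>v\<close> is the one for the eigenvalue.
\<close>

definition double_star_eigenvector ::
    "'v::finite set \<Rightarrow> 'v \<Rightarrow> 'v \<Rightarrow> real \<Rightarrow> complex ^ 'v" where
  "double_star_eigenvector K u v \<mu> = (\<chi> x. complex_of_real
     (if x \<in> K then 1 else if x = u then \<mu> else if x = v then \<mu>\<^sup>2 - card K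
      else (\<mu>\<^sup>2 - card K) / \<mu>))"

text \<open>Fixes the witnesses of \<open>double_star\<close>; their sizes enter the eigenvalue
  equation as \<open>card K\<close> and \<open>card L\<close>.\<close>

locale double_star_graph =
  fixes K L :: "'v::finite set" and u v :: 'v and E :: "'v set set"
  assumes uv: "u \<noteq> v"
    and KL: "K \<inter> L = {}"
    and disj: "{u, v} \<inter> (K \<union> L) = {}"
    and cover: "{u, v} \<union> K \<union> L = UNIV"
    and E: "E = star_edges u K \<union> star_edges v L \<union> {{u, v}}"
begin

lemma notin [simp]: "u \<notin> K" "v \<notin> K" "u \<notin> L" "v \<notin> L"
  using disj by auto

lemma neighbours:
  shows "{b. {u, b} \<in> E} = insert v K"
    and "{b. {v, b} \<in> E} = insert u L"
    and "x \<in> K \<Longrightarrow> {b. {x, b} \<in> E} = {u}"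
    and "x \<in> L \<Longrightarrow> {b. {x, b} \<in> E} = {v}"
  using uv KL disj unfolding E star_edges_def by (auto simp: doubleton_eq_iff)

lemma vertex_cases: "x = u \<or> x = v \<or> x \<in> K \<or> x \<in> L"
  using cover by auto

lemma double_star_eigenvector:
  fixes \<mu> :: real
  assumes "\<mu> \<noteq> 0" and char: "\<mu> ^ 4 - (card K + card L + 1) * \<mu>\<^sup>2 + card K * card L = 0"
  shows "adjacency_matrix E *v double_star_eigenvector K u v \<mu>
    = complex_of_real \<mu> *s double_star_eigenvector K u v \<mu>"
    (is "_ *v ?w = _")
proof -
  have w: "?w $ u = of_real \<mu>" "?w $ v = of_real (\<mu>\<^sup>2 - card K)"
    "x \<in> K \<Longrightarrow> ?w $ x = 1" "x \<in> L \<Longrightarrow> ?w $ x = of_real ((\<mu>\<^sup>2 - card K) / \<mu>)" for x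
    using uv KL notin by (auto simp: double_star_eigenvector_def)
  \<comment> \<open>After multiplication by \<open>\<mu>\<close> this is
    \<open>char\<close>.\<close>
  have at_v: "\<mu> + card L * ((\<mu>\<^sup>2 - card K) / \<mu>) = \<mu> * (\<mu>\<^sup>2 - card K)"
    using assms by (simp add: field_simps power2_eq_square power4_eq_xxxx)
  have "(adjacency_matrix E *v ?w) $ x = of_real \<mu> * ?w $ x" for x
    using vertex_cases[of x]
  proof (elim disjE)
    assume "x = u"
    then show ?thesis
      by (simp add: adjacency_matrix_mult_nth neighbours w power2_eq_square)
  next
    assume x: "x = v"
    have "(adjacency_matrix E *v ?w) $ v = of_real (\<mu> + card L * ((\<mu>\<^sup>2 - card K) / \<mu>))"
      by (simp add: adjacency_matrix_mult_nth neighbours w)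
    then show ?thesis
      unfolding x at_v w(2) by simp
  next
    assume "x \<in> K"
    then show ?thesis
      by (simp add: adjacency_matrix_mult_nth neighbours w)
  next
    assume "x \<in> L"
    then show ?thesis
      using assms(1) by (simp add: adjacency_matrix_mult_nth neighbours w)
  qed
  then show ?thesis by (simp add: vec_eq_iff)
qed

text \<open>Leaves in \<open>K\<close> see only \<open>u\<close>, and at \<open>u\<close> the
  entries 1 and -1 cancel. The factor 0 is kept so that the general eigenvector lemma
  applies.\<close>

lemma leaf_difference_eigenvector:
  assumes "a \<in> K" "b \<in> K"
  shows "adjacency_matrix E *v (axis a 1 - axis b 1) = 0 *s (axis a 1 - axis b 1)"
    (is "_ *v ?w = _")
proof -
  have [simp]: "u \<noteq> a" "u \<noteq> b" "v \<noteq> a" "v \<noteq> b"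
    using assms notin by metis+
  have "(adjacency_matrix E *v ?w) $ x = 0" for x
    using vertex_cases[of x]
  proof (elim disjE)
    assume "x = u"
    then show ?thesis
      using assms by (auto simp: adjacency_matrix_mult_nth neighbours axis_def sum_subtractf)
  next
    assume "x = v"
    moreover have "\<forall>y\<in>insert u L. ?w $ y = 0"
      using assms KL notin by (auto simp: axis_def)
    ultimately show ?thesis
      by (simp add: adjacency_matrix_mult_nth neighbours(2))
  qed (use assms in \<open>auto simp: adjacency_matrix_mult_nth neighbours axis_def\<close>)
  then show ?thesis by (simp add: vec_eq_iff)
qed

text \<open>Equal weights on \<open>\<mu>\<close> and \<open>-\<mu>\<close> cancel the entries at
  \<open>u\<close> and on \<open>L\<close>, which are odd in \<open>\<mu>\<close>. The two remaining
  conditions, total 1/2 on \<open>K\<close> and 0 at \<open>v\<close>, are linear equations with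
  solution \<open>P\<close>, \<open>Q\<close>.\<close>

lemma axis_decomposition:
  fixes \<alpha> \<beta> :: real
  assumes K: "K = {a, b}" "a \<noteq> b" and "\<alpha> \<noteq> 0" "\<beta> \<noteq> 0" "\<alpha>\<^sup>2 \<noteq> \<beta>\<^sup>2"
  defines "w \<equiv> double_star_eigenvector K u v"
    and "P \<equiv> complex_of_real ((\<beta>\<^sup>2 - 2) / (4 * (\<beta>\<^sup>2 - \<alpha>\<^sup>2)))"
    and "Q \<equiv> complex_of_real ((2 - \<alpha>\<^sup>2) / (4 * (\<beta>\<^sup>2 - \<alpha>\<^sup>2)))"
  shows "axis a 1 = (1/2) *s (axis a 1 - axis b 1)
    + P *s w \<alpha> + P *s w (-\<alpha>) + Q *s w \<beta> + Q *s w (-\<beta>)"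
proof -
  have card: "card K = 2" using K by simp
  define p q where "p = (\<beta>\<^sup>2 - 2) / (4 * (\<beta>\<^sup>2 - \<alpha>\<^sup>2))" and "q = (2 - \<alpha>\<^sup>2) / (4 * (\<beta>\<^sup>2 - \<alpha>\<^sup>2))"
  have ne: "\<beta>\<^sup>2 - \<alpha>\<^sup>2 \<noteq> 0" using assms by simp
  have leaf: "p + p + q + q = 1/2"
    unfolding p_def q_def using ne by (simp add: divide_simps)
  have "(\<beta>\<^sup>2 - 2) * (\<alpha>\<^sup>2 - 2) = - ((2 - \<alpha>\<^sup>2) * (\<beta>\<^sup>2 - 2))" by algebra
  then have "p * (\<alpha>\<^sup>2 - 2) = - (q * (\<beta>\<^sup>2 - 2))"
    unfolding p_def q_def by (simp only: times_divide_eq_left minus_divide_left)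
  then have at_v: "p * (\<alpha>\<^sup>2 - 2) + p * (\<alpha>\<^sup>2 - 2) + q * (\<beta>\<^sup>2 - 2) + q * (\<beta>\<^sup>2 - 2) = 0"
    by simp
  have PQ: "P = of_real p" "Q = of_real q" by (simp_all add: P_def Q_def p_def q_def)
  have sum: "P * w \<alpha> $ x + P * w (-\<alpha>) $ x + Q * w \<beta> $ x + Q * w (-\<beta>) $ x
      = of_real (if x \<in> K then 1/2 else 0)" for x
  proof -
    consider "x \<in> K" | "x = u" | "x = v" | "x \<in> L" using vertex_cases by blast
    then show ?thesis
    proof cases
      case 1
      then have "P * w \<alpha> $ x + P * w (-\<alpha>) $ x + Q * w \<beta> $ x + Q * w (-\<beta>) $ x
          = of_real (p + p + q + q)"
        by (simp add: PQ w_def double_star_eigenvector_def)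
      with 1 show ?thesis unfolding leaf by simp
    next
      case 3
      then have "P * w \<alpha> $ x + P * w (-\<alpha>) $ x + Q * w \<beta> $ x + Q * w (-\<beta>) $ x
          = of_real (p * (\<alpha>\<^sup>2 - 2) + p * (\<alpha>\<^sup>2 - 2) + q * (\<beta>\<^sup>2 - 2) + q * (\<beta>\<^sup>2 - 2))"
        using uv by (simp add: PQ w_def double_star_eigenvector_def card)
      with 3 show ?thesis unfolding at_v by simp
    next
      case 4
      then have "x \<notin> K" "x \<noteq> u" "x \<noteq> v" using KL notin by auto
      then show ?thesis
        by (simp add: w_def double_star_eigenvector_def card)
    qed (use notin in \<open>simp add: w_def double_star_eigenvector_def\<close>)
  qed
  have "axis a 1 $ x = ((1/2) *s (axis a 1 - axis b 1)
    + P *s w \<alpha> + P *s w (-\<alpha>) + Q *s w \<beta> + Q *s w (-\<beta>)) $ x" for x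
    using sum[of x] K by (auto simp: axis_def add.assoc)
  then show ?thesis unfolding vec_eq_iff by blast
qed

text \<open>The eigenvalue equation is even, so the negatives of \<open>\<alpha>\<close> and
  \<open>\<beta>\<close> are eigenvalues too. Each summand of \<open>axis_decomposition\<close>
  picks up its own phase, and the kernel part stays fixed.\<close>

lemma transition_axis:
  fixes \<alpha> \<beta> :: real
  assumes K: "K = {a, b}" "a \<noteq> b" and "\<alpha> \<noteq> 0" "\<beta> \<noteq> 0" "\<alpha>\<^sup>2 \<noteq> \<beta>\<^sup>2"
    and char: "\<alpha> ^ 4 - (card L + 3) * \<alpha>\<^sup>2 + 2 * card L = 0"
      "\<beta> ^ 4 - (card L + 3) * \<beta>\<^sup>2 + 2 * card L = 0"
  defines "w \<equiv> double_star_eigenvector K u v"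
    and "P \<equiv> complex_of_real ((\<beta>\<^sup>2 - 2) / (4 * (\<beta>\<^sup>2 - \<alpha>\<^sup>2)))"
    and "Q \<equiv> complex_of_real ((2 - \<alpha>\<^sup>2) / (4 * (\<beta>\<^sup>2 - \<alpha>\<^sup>2)))"
  shows "transition_matrix E t *v axis a 1 = (1/2) *s (axis a 1 - axis b 1)
    + (P * cis (t * \<alpha>)) *s w \<alpha> + (P * cis (- (t * \<alpha>))) *s w (-\<alpha>)
    + (Q * cis (t * \<beta>)) *s w \<beta> + (Q * cis (- (t * \<beta>))) *s w (-\<beta>)"
proof -
  have card: "card K = 2" using K by simp
  have U: "transition_matrix E t *v w \<mu> = cis (t * \<mu>) *s w \<mu>"
    if "\<mu> \<noteq> 0" "\<mu> ^ 4 - (card L + 3) * \<mu>\<^sup>2 + 2 * card L = 0" for \<mu> :: real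
    unfolding w_def cis_conv_exp
    using transition_matrix_eigenvector[OF double_star_eigenvector[of \<mu>]] that
    by (simp add: card algebra_simps)
  have U0: "transition_matrix E t *v (axis a 1 - axis b 1) = axis a 1 - axis b 1"
    using transition_matrix_eigenvector[OF leaf_difference_eigenvector[of a b]] K by simp
  have U\<alpha>\<beta>: "transition_matrix E t *v w \<alpha> = cis (t * \<alpha>) *s w \<alpha>"
    "transition_matrix E t *v w (-\<alpha>) = cis (- (t * \<alpha>)) *s w (-\<alpha>)"
    "transition_matrix E t *v w \<beta> = cis (t * \<beta>) *s w \<beta>"
    "transition_matrix E t *v w (-\<beta>) = cis (- (t * \<beta>)) *s w (-\<beta>)"
    using U[of \<alpha>] U[of "-\<alpha>"] U[of \<beta>] U[of "-\<beta>"] char assms(3,4) by simp_all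
  show ?thesis
    by (subst axis_decomposition[OF assms(1-5), folded w_def P_def Q_def])
       (simp only: matrix_vector_right_distrib vector_scalar_commute U\<alpha>\<beta> U0 vector_smult_assoc)
qed

end

section \<open>Times at which two phases are nearly opposite to their start\<close>

text \<open>A chord of the unit circle is no longer than its arc; the chord length is twice the
  absolute value of \<open>sin (x / 2)\<close>.\<close>

lemma norm_cis_minus_1_le: "norm (cis x - 1) \<le> \<bar>x\<bar>"
proof -
  have "(norm (cis x - 1))\<^sup>2 = (cos x - 1)\<^sup>2 + (sin x)\<^sup>2"
    by (simp add: cmod_power2)
  also have "\<dots> = 2 - 2 * cos x"
    using sin_cos_squared_add[of x] by (simp add: power2_eq_square algebra_simps)
  also have "\<dots> = (2 * sin (x / 2))\<^sup>2"
    using cos_double_sin[of "x / 2"] by (simp add: power2_eq_square)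
  also have "\<dots> \<le> x\<^sup>2"
    using abs_sin_x_le_abs_x[of "x / 2"] by (subst abs_le_square_iff[symmetric]) simp
  finally show ?thesis
    by (simp flip: abs_le_square_iff)
qed

text \<open>Kronecker's theorem in dimension one: restricting \<open>t * \<alpha>\<close> to odd
  multiples of \<open>pi\<close> makes the first phase exact and leaves an integer \<open>k\<close>
  free to steer the second.\<close>

lemma simultaneous_antiphase:
  fixes \<alpha> \<beta> :: real
  assumes "\<alpha> \<noteq> 0" "\<beta> / \<alpha> \<notin> \<rat>" "\<delta> > 0"
  obtains t where "cis (t * \<alpha>) = -1" "norm (cis (t * \<beta>) + 1) < \<delta>"
proof -
  have "\<delta> / (2 * pi) > 0" using assms(3) by simp
  \<comment> \<open>With \<open>t * \<alpha> = (2 * k + 1) * pi\<close>, the number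
    \<open>t * \<beta> / (2 * pi)\<close> is \<open>(k + 1/2) * (\<beta> / \<alpha>)\<close>, which
    has to be close to \<open>h + 1/2\<close>; this fixes the target.\<close>
  then obtain h k :: int
    where hk: "\<bar>of_int k * (\<beta> / \<alpha>) - of_int h - (1/2 - \<beta> / \<alpha> / 2)\<bar> < \<delta> / (2 * pi)"
    by (rule sequence_of_fractional_parts_is_dense[OF assms(2)])
  define t where "t = (2 * of_int k + 1) * pi / \<alpha>"
  have odd: "cis ((2 * of_int n + 1) * pi) = -1" for n :: int
    using cis_multiple_2pi[of "of_int n"] cis_mult[of "2 * pi * of_int n" pi]
    by (simp add: algebra_simps)
  \<comment> \<open>The phase error relative to the nearby odd multiple of
    \<open>pi\<close>.\<close>
  let ?r = "t * \<beta> - (2 * of_int h + 1) * pi"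
  have "?r = 2 * pi * (of_int k * (\<beta> / \<alpha>) - of_int h - (1/2 - \<beta> / \<alpha> / 2))"
    using assms(1) by (simp add: t_def field_simps)
  then have "\<bar>?r\<bar> = 2 * pi * \<bar>of_int k * (\<beta> / \<alpha>) - of_int h - (1/2 - \<beta> / \<alpha> / 2)\<bar>"
    by (simp only: abs_mult) simp
  also have "\<dots> < \<delta>" using hk by (simp add: field_simps)
  finally have r: "\<bar>?r\<bar> < \<delta>" .
  have "cis (t * \<beta>) = cis ?r * cis ((2 * of_int h + 1) * pi)"
    by (simp only: cis_mult) simp
  then have "cis (t * \<beta>) + 1 = - (cis ?r - 1)" unfolding odd by simp
  then have "norm (cis (t * \<beta>) + 1) < \<delta>"
    using norm_cis_minus_1_le[of ?r] r by (simp only: norm_minus_cancel)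
  moreover have "cis (t * \<alpha>) = -1" using odd[of k] assms(1) by (simp add: t_def)
  ultimately show ?thesis using that by blast
qed

section \<open>Irrationality of the ratio of the eigenvalues\<close>

text \<open>In lowest terms, the squared denominator divides the squared numerator, to which it is
  coprime, so it is 1.\<close>

lemma rational_square_root_of_int:
  fixes x :: real
  assumes "x \<in> \<rat>" "x\<^sup>2 = of_int d"
  obtains m :: int where "x = of_int m"
proof -
  obtain p q :: int where pq: "q > 0" "coprime p q" "x = of_int p / of_int q"
    using assms(1) by (rule Rats_cases')
  have "of_int (p\<^sup>2) = (of_int (d * q\<^sup>2) :: real)"
    using assms(2) pq by (simp add: field_simps)
  then have "p\<^sup>2 = d * q\<^sup>2" by (simp only: of_int_eq_iff)
  then have "q\<^sup>2 dvd p\<^sup>2" by simp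
  moreover have "coprime (p\<^sup>2) (q\<^sup>2)" using pq by simp
  ultimately have "is_unit (q\<^sup>2)" by (metis coprime_common_divisor dvd_refl)
  then have "q = 1" using pq(1) by (auto simp: power2_eq_1_iff)
  then show ?thesis using that pq by simp
qed

text \<open>The next square after that of \<open>k\<close> is \<open>2 * k + 1\<close> larger, so a
  gap of 8 forces \<open>k\<close> to be at most 3. Of 8, 9, 12, 17 only 9 is a square.\<close>

lemma square_plus_8_eq_square:
  fixes k m :: int
  assumes "m\<^sup>2 = k\<^sup>2 + 8" "k \<ge> 0"
  shows "k = 1"
proof -
  define n where "n = \<bar>m\<bar>"
  have n: "n \<ge> 0" "n * n = k * k + 8"
    using assms by (simp_all add: n_def power2_eq_square abs_mult_self_eq)
  have "k < n"
  proof (rule ccontr)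
    assume "\<not> k < n"
    then have "n * n \<le> k * k" using n(1) by (intro mult_mono) auto
    with n(2) show False by simp
  qed
  then have "(k + 1) * (k + 1) \<le> n * n" using assms by (intro mult_mono) auto
  then have "k \<le> 3" unfolding n(2) by (simp add: algebra_simps)
  then have "k = 0 \<or> k = 1 \<or> k = 2 \<or> k = 3" using assms by auto
  \<comment> \<open>Bounding \<open>n\<close> as well leaves finitely many pairs to check.\<close>
  moreover have "n < 5"
  proof (rule ccontr)
    assume "\<not> n < 5"
    then have "5 * 5 \<le> n * n" by (intro mult_mono) auto
    moreover have "k * k \<le> 3 * 3" using \<open>k \<le> 3\<close> assms by (intro mult_mono) auto
    ultimately show False using n(2) by simp
  qed
  then have "n = 0 \<or> n = 1 \<or> n = 2 \<or> n = 3 \<or> n = 4" using n(1) by auto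
  ultimately show ?thesis using n(2) by auto
qed

lemma eigenvalues_incommensurable:
  fixes l :: nat
  assumes "l \<ge> 1" "l \<noteq> 2"
  obtains \<alpha> \<beta> :: real where "\<alpha> \<noteq> 0" "\<beta> \<noteq> 0" "\<alpha>\<^sup>2 \<noteq> \<beta>\<^sup>2" "\<beta> / \<alpha> \<notin> \<rat>"
    "\<alpha> ^ 4 - (l + 3) * \<alpha>\<^sup>2 + 2 * l = 0" "\<beta> ^ 4 - (l + 3) * \<beta>\<^sup>2 + 2 * l = 0"
proof -
  \<comment> \<open>The root of the discriminant of \<open>x\<^sup>2 - (l + 3) * x + 2 * l\<close>,
    whose zeros are the squared eigenvalues.\<close>
  define s where "s = sqrt ((real l - 1)\<^sup>2 + 8)"
  have s2: "s\<^sup>2 = (real l - 1)\<^sup>2 + 8" unfolding s_def by simp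
  have "s > 0" unfolding s_def by (auto intro: add_nonneg_pos)
  \<comment> \<open>The difference of the two sides is \<open>8 * l\<close>; this makes the smaller
    zero positive, hence \<open>\<beta>\<close> nonzero.\<close>
  have "s\<^sup>2 < (real l + 3)\<^sup>2" unfolding s2 using assms by (simp add: power2_eq_square algebra_simps)
  then have "s < real l + 3" by (rule power_less_imp_less_base) simp
  define \<alpha> where "\<alpha> = sqrt ((real l + 3 + s) / 2)"
  define \<beta> where "\<beta> = sqrt ((real l + 3 - s) / 2)"
  have \<alpha>2: "\<alpha>\<^sup>2 = (real l + 3 + s) / 2" and \<beta>2: "\<beta>\<^sup>2 = (real l + 3 - s) / 2"
    unfolding \<alpha>_def \<beta>_def using \<open>s > 0\<close> \<open>s < real l + 3\<close> by simp_all
  have "\<alpha> \<noteq> 0" "\<beta> \<noteq> 0" unfolding \<alpha>_def \<beta>_def using \<open>s > 0\<close> \<open>s < real l + 3\<close> by simp_all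
  have p4: "x ^ 4 = (x\<^sup>2)\<^sup>2" for x :: real by simp
  have "\<beta> / \<alpha> \<notin> \<rat>"
  proof
    assume r: "\<beta> / \<alpha> \<in> \<rat>"
    have "\<alpha>\<^sup>2 * (1 + (\<beta> / \<alpha>)\<^sup>2) = \<alpha>\<^sup>2 + \<beta>\<^sup>2"
      using \<open>\<alpha> \<noteq> 0\<close> by (simp add: power_divide algebra_simps)
    also have "\<dots> = real l + 3" unfolding \<alpha>2 \<beta>2 by (simp add: field_simps)
    finally have "\<alpha>\<^sup>2 = (real l + 3) / (1 + (\<beta> / \<alpha>)\<^sup>2)"
      using sum_power2_gt_zero_iff[of 1 "\<beta> / \<alpha>"] by (simp add: field_simps)
    also have "\<dots> \<in> \<rat>" using r by simp
    finally have "2 * \<alpha>\<^sup>2 - (real l + 3) \<in> \<rat>" by simp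
    moreover have "2 * \<alpha>\<^sup>2 - (real l + 3) = s" unfolding \<alpha>2 by (simp add: field_simps)
    ultimately have "s \<in> \<rat>" by simp
    moreover have "s\<^sup>2 = of_int ((int l - 1)\<^sup>2 + 8)" using s2 by simp
    ultimately obtain m :: int where m: "s = of_int m"
      by (rule rational_square_root_of_int)
    have "of_int (m\<^sup>2) = (of_int ((int l - 1)\<^sup>2 + 8) :: real)" using s2 m by simp
    then have "m\<^sup>2 = (int l - 1)\<^sup>2 + 8" by (simp only: of_int_eq_iff)
    \<comment> \<open>Here \<open>k\<close> is \<open>int l - 1\<close>, nonnegative since
      \<open>l \<ge> 1\<close>; the value 1 would mean \<open>l = 2\<close>.\<close>
    from square_plus_8_eq_square[OF this] assms show False by simp
  qed
  moreover have "\<alpha>\<^sup>2 \<noteq> \<beta>\<^sup>2" unfolding \<alpha>2 \<beta>2 using \<open>s > 0\<close> by simp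
  moreover have "\<alpha> ^ 4 - (l + 3) * \<alpha>\<^sup>2 + 2 * l = 0" "\<beta> ^ 4 - (l + 3) * \<beta>\<^sup>2 + 2 * l = 0"
    unfolding p4 \<alpha>2 \<beta>2 using s2 by (simp_all add: power2_eq_square field_simps)
  ultimately show ?thesis using that \<open>\<alpha> \<noteq> 0\<close> \<open>\<beta> \<noteq> 0\<close> by blast
qed

section \<open>Transfer between the two leaves of \<open>u\<close>\<close>

context double_star_graph
begin

text \<open>With the \<open>\<alpha>\<close> phases exactly -1, only the \<open>\<beta>\<close>
  terms contribute to the error, and it shrinks with their distance from -1.\<close>

lemma pretty_good_state_transfer_leaves:
  assumes K: "K = {a, b}" "a \<noteq> b" and L: "card L \<ge> 1" "card L \<noteq> 2"
  shows "pretty_good_state_transfer E a b"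
proof -
  obtain \<alpha> \<beta> :: real where ab: "\<alpha> \<noteq> 0" "\<beta> \<noteq> 0" "\<alpha>\<^sup>2 \<noteq> \<beta>\<^sup>2"
    and irr: "\<beta> / \<alpha> \<notin> \<rat>"
    and char: "\<alpha> ^ 4 - (card L + 3) * \<alpha>\<^sup>2 + 2 * card L = 0"
      "\<beta> ^ 4 - (card L + 3) * \<beta>\<^sup>2 + 2 * card L = 0"
    using eigenvalues_incommensurable[OF L] .
  let ?w = "double_star_eigenvector K u v"
  define P where "P = complex_of_real ((\<beta>\<^sup>2 - 2) / (4 * (\<beta>\<^sup>2 - \<alpha>\<^sup>2)))"
  define Q where "Q = complex_of_real ((2 - \<alpha>\<^sup>2) / (4 * (\<beta>\<^sup>2 - \<alpha>\<^sup>2)))"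
  have "\<exists>t. norm (transition_matrix E t *v axis a 1 - (-1) *s axis b 1) < \<epsilon>" if "\<epsilon> > 0" for \<epsilon>
  proof -
    \<comment> \<open>The summand 1 makes \<open>C\<close> positive without examining the two
      norms.\<close>
    define C where "C = norm (Q *s ?w \<beta>) + norm (Q *s ?w (-\<beta>)) + 1"
    have "C > 0" unfolding C_def by (simp add: add_nonneg_pos)
    obtain t where t\<alpha>: "cis (t * \<alpha>) = -1" and t\<beta>: "norm (cis (t * \<beta>) + 1) < \<epsilon> / C"
      using simultaneous_antiphase[OF ab(1) irr, of "\<epsilon> / C"] \<open>\<epsilon> > 0\<close> \<open>C > 0\<close> by auto
    have t\<alpha>': "cis (- (t * \<alpha>)) = -1" using t\<alpha> by (simp flip: cis_inverse)
    define z where "z = cis (t * \<beta>) + 1"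
    have z: "cis (t * \<beta>) = z - 1" "cis (- (t * \<beta>)) = cnj z - 1"
      by (simp_all add: z_def flip: cis_cnj)
    \<comment> \<open>One coordinate of the error: adding the evolved vector \<open>y\<close> to the
      decomposition of \<open>A\<close> cancels everything except twice the kernel part and the
      terms in \<open>z\<close>; the kernel parts sum to \<open>A - B\<close>.\<close>
    have combine: "y + B = z * (Q * w3) + cnj z * (Q * w4)"
      if "y = 1/2 * (A - B) + P * -1 * w1 + P * -1 * w2 + Q * (z - 1) * w3 + Q * (cnj z - 1) * w4"
        and "A = 1/2 * (A - B) + P * w1 + P * w2 + Q * w3 + Q * w4"
      for y A B w1 w2 w3 w4
    proof -
      have "y + B = y + A - 1/2 * (A - B) - 1/2 * (A - B)" by (simp add: field_simps)
      also have "\<dots> = z * (Q * w3) + cnj z * (Q * w4)"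
        by (subst (1) that(1), subst (2) that(2)) (simp add: algebra_simps)
      finally show ?thesis .
    qed
    have "transition_matrix E t *v axis a 1 + axis b 1
        = z *s (Q *s ?w \<beta>) + cnj z *s (Q *s ?w (-\<beta>))"
      unfolding vec_eq_iff vector_add_component vector_smult_component
      using transition_axis[OF K ab char, of t, folded P_def Q_def, unfolded t\<alpha> t\<alpha>' z]
        axis_decomposition[OF K ab, folded P_def Q_def]
      unfolding vec_eq_iff vector_add_component vector_smult_component vector_minus_component
      by (intro allI combine) blast+
    moreover have norm_smult: "norm (c *s y) = norm c * norm y" for c and y :: "complex ^ 'v"
      by (simp add: norm_vec_def norm_mult L2_set_right_distrib)
    ultimately have "norm (transition_matrix E t *v axis a 1 + axis b 1)
        \<le> norm z * norm (Q *s ?w \<beta>) + norm z * norm (Q *s ?w (-\<beta>))"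
      by (metis complex_mod_cnj norm_triangle_ineq)
    also have "\<dots> \<le> norm z * C"
      unfolding C_def by (simp add: algebra_simps)
    also have "\<dots> < \<epsilon>"
      using t\<beta> \<open>C > 0\<close> unfolding z_def by (simp add: field_simps)
    finally have "norm (transition_matrix E t *v axis a 1 - (-1) *s axis b 1) < \<epsilon>"
      by (simp add: vector_sneg_minus1[symmetric])
    then show ?thesis ..
  qed
  then show ?thesis
    unfolding pretty_good_state_transfer_def using K(2) by blast
qed

text \<open>
  The eigenvalues are here \<open>0\<close>, \<open>\<plusminus>1\<close>, \<open>\<plusminus>2\<close>, and the return amplitude at the leaf is
  \<open>1/4 + (2 * cos t + 1)\<^sup>2 / 12\<close>.
\<close>

lemma not_pretty_good_state_transfer_leaves:
  assumes K: "K = {a, b}" "a \<noteq> b" and L: "card L = 2"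
  shows "\<not> pretty_good_state_transfer E a b"
proof
  assume "pretty_good_state_transfer E a b"
  \<comment> \<open>The coordinate at \<open>a\<close> of \<open>\<gamma> *s axis b 1\<close> is 0,
    so the error is at least the return amplitude, which never drops below 1/4.\<close>
  then obtain \<gamma> t where close: "norm (transition_matrix E t *v axis a 1 - \<gamma> *s axis b 1) < 1/4"
    unfolding pretty_good_state_transfer_def by (meson zero_less_divide_1_iff zero_less_numeral)
  have cis_sum: "cis x + cis (-x) = of_real (2 * cos x)" for x
    by (simp add: complex_eq_iff)
  \<comment> \<open>The constants 1/6 and 1/12 are \<open>P\<close> and \<open>Q\<close> for
    \<open>\<alpha> = 1\<close>, \<open>\<beta> = 2\<close>.\<close>
  have U: "transition_matrix E t *v axis a 1 = (1/2) *s (axis a 1 - axis b 1)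
    + (of_real (1/6) * cis t) *s double_star_eigenvector K u v 1
    + (of_real (1/6) * cis (-t)) *s double_star_eigenvector K u v (-1)
    + (of_real (1/12) * cis (t * 2)) *s double_star_eigenvector K u v 2
    + (of_real (1/12) * cis (- (t * 2))) *s double_star_eigenvector K u v (-2)"
    using transition_axis[OF K, of 1 2 t] L by simp
  have at_a: "double_star_eigenvector K u v \<mu> $ a = 1" "axis a 1 $ a = (1 :: complex)"
    "axis b 1 $ a = (0 :: complex)" for \<mu>
    using K by (simp_all add: double_star_eigenvector_def axis_def)
  have "(transition_matrix E t *v axis a 1 - \<gamma> *s axis b 1) $ a
      = 1/2 + of_real (1/6) * (cis t + cis (-t)) + of_real (1/12) * (cis (t * 2) + cis (-(t * 2)))"
    unfolding U by (simp add: at_a algebra_simps)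
  \<comment> \<open>Complete the square after
    \<open>cos (2 * t) = 2 * (cos t)\<^sup>2 - 1\<close>.\<close>
  also have "\<dots> = of_real (1/4 + (2 * cos t + 1)\<^sup>2 / 12)"
    unfolding cis_sum using cos_double_cos[of t]
    by (simp add: complex_eq_iff power2_eq_square field_simps)
  finally have "norm ((transition_matrix E t *v axis a 1 - \<gamma> *s axis b 1) $ a) \<ge> 1/4"
    by (simp only: norm_of_real) (rule order_trans[OF _ abs_ge_self], simp)
  then show False
    using close Finite_Cartesian_Product.norm_nth_le[of
        "transition_matrix E t *v axis a 1 - \<gamma> *s axis b 1" a]
    by linarith
qed

end

theorem theorem5p2:
  fixes E :: "'v::finite set set" and u v u1 u2 :: 'v and l :: nat
  assumes "l \<ge> 1"
    and "double_star 2 l E u v"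
    and "u1 \<noteq> u2"
    and "{u, u1} \<in> E" and "degree E u1 = 1"
    and "{u, u2} \<in> E" and "degree E u2 = 1"
  shows "pretty_good_state_transfer E u1 u2 \<longleftrightarrow> l \<noteq> 2"
proof -
  obtain K L where K: "card K = 2" and L: "card L = l" and "double_star_graph K L u v E"
    using assms(2) unfolding double_star_def double_star_graph_def by blast
  then interpret double_star_graph K L u v E by blast
  \<comment> \<open>Among the neighbours of \<open>u\<close>, the degree excludes \<open>v\<close>,
    which has degree \<open>l + 1 \<ge> 2\<close>.\<close>
  have leaf: "x \<in> K" if "{u, x} \<in> E" "degree E x = 1" for x
  proof -
    have "x \<in> insert v K" using that(1) neighbours(1) by blast
    moreover have "x \<noteq> v" using that(2) double_star_degree_right[OF assms(2)] assms(1) by auto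
    ultimately show ?thesis by blast
  qed
  have "{u1, u2} \<subseteq> K" using leaf assms by blast
  then have "K = {u1, u2}"
    using K assms(3) by (metis card_2_iff card_subset_eq finite)
  then show ?thesis
    using pretty_good_state_transfer_leaves[of u1 u2] not_pretty_good_state_transfer_leaves[of u1 u2]
      assms L by blast
qed

end
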